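(* Let $(T(t))_{t\ge 0}$ be a bounded $C_0$-semigroup on a Banach space $X$, with generator $-A$. Assume that $\sigma(A)\cap i\mathbb{R}=\{0\}$ and that $$\lim_{s\to 0}\max\left(\|s(is+A)^{-1}\|,\|s(-is+A)^{-1}\|\right)=\infty.$$ Define $$M(s)=\sup\left\{\|(ir+A)^{-1}\| : 1\le|r|\le s\right\},\quad s\ge 1,$$ $$m(s)=\sup\left\{\|(ir+A)^{-1}\| : s<|r|\le 1\right\},\quad 0<s<1,$$ and assume that $\lim_{s\to\infty}M(s)=\infty$. Then there exist $c,c',C'>0$ such that $$\|T(t)A(I+A)^{-2}\|\ge c\max\left(m^{-1}(c't),\frac{1}{M^{-1}(C't)}\right)$$ for all sufficiently large $t$.
   Context: The generator of the semigroup is $-A$. The function $M$ is continuous and increasing, and $m$ is continuous and decreasing with $m(s)\to\infty$ as $s\to 0+$. $M^{-1}$ and $m^{-1}$ denote right inverses of $M$ and $m$ (that is, $M(M^{-1}(t))=t$ and $m(m^{-1}(t))=t$), defined for all sufficiently large $t$. *)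

theory Defs
  imports "HOL-Analysis.Analysis"
begin

text \<open>Complex Banach spaces: the complex scalar multiplication extends the real one, and
  the norm is homogeneous for complex scalars.\<close>

class complex_normed_vector = real_normed_vector +
  fixes scaleC :: "complex \<Rightarrow> 'a \<Rightarrow> 'a" (infixr \<open>*\<^sub>C\<close> 75)
  assumes scaleC_of_real: "complex_of_real r *\<^sub>C x = r *\<^sub>R x"
    and scaleC_add_right: "a *\<^sub>C (x + y) = a *\<^sub>C x + a *\<^sub>C y"
    and scaleC_add_left: "(a + b) *\<^sub>C x = a *\<^sub>C x + b *\<^sub>C x"
    and scaleC_scaleC: "a *\<^sub>C b *\<^sub>C x = (a * b) *\<^sub>C x"
    and norm_scaleC: "norm (a *\<^sub>C x) = cmod a * norm x"

class complex_banach = complex_normed_vector + banach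

definition bounded_clinear :: "('a::complex_normed_vector \<Rightarrow> 'b::complex_normed_vector) \<Rightarrow> bool"
  where "bounded_clinear f \<longleftrightarrow> bounded_linear f \<and> (\<forall>a x. f (a *\<^sub>C x) = a *\<^sub>C f x)"

text \<open>A semigroup is a function of a real parameter whose values at negative times are
  irrelevant.\<close>

definition C0_semigroup :: "(real \<Rightarrow> 'a::complex_banach \<Rightarrow> 'a) \<Rightarrow> bool"
  where "C0_semigroup T \<longleftrightarrow>
    (\<forall>t\<ge>0. bounded_clinear (T t)) \<and>
    T 0 = id \<and>
    (\<forall>s\<ge>0. \<forall>t\<ge>0. T (s + t) = T s \<circ> T t) \<and>
    (\<forall>x. ((\<lambda>t. T t x) \<longlongrightarrow> x) (at_right 0))"

definition bounded_semigroup :: "(real \<Rightarrow> 'a::complex_banach \<Rightarrow> 'a) \<Rightarrow> bool"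
  where "bounded_semigroup T \<longleftrightarrow> (\<exists>K. \<forall>t\<ge>0. onorm (T t) \<le> K)"

text \<open>An unbounded operator is given by its domain \<open>D\<close> together with a function whose
  values outside \<open>D\<close> are irrelevant.\<close>

definition is_generator ::
    "(real \<Rightarrow> 'a::complex_banach \<Rightarrow> 'a) \<Rightarrow> 'a set \<Rightarrow> ('a \<Rightarrow> 'a) \<Rightarrow> bool"
  where "is_generator T D B \<longleftrightarrow>
    D = {x. \<exists>y. ((\<lambda>h. (T h x - x) /\<^sub>R h) \<longlongrightarrow> y) (at_right 0)} \<and>
    (\<forall>x\<in>D. ((\<lambda>h. (T h x - x) /\<^sub>R h) \<longlongrightarrow> B x) (at_right 0))"

definition op_resolvent_set :: "'a::complex_banach set \<Rightarrow> ('a \<Rightarrow> 'a) \<Rightarrow> complex set"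
  where "op_resolvent_set D A =
    {z. bij_betw (\<lambda>x. z *\<^sub>C x - A x) D UNIV \<and>
        bounded_clinear (inv_into D (\<lambda>x. z *\<^sub>C x - A x))}"

definition op_spectrum :: "'a::complex_banach set \<Rightarrow> ('a \<Rightarrow> 'a) \<Rightarrow> complex set"
  where "op_spectrum D A = - op_resolvent_set D A"

text \<open>\<open>shift_inv D A z\<close> is $(z + A)^{-1}$; it is meaningful when $-z$ is in the
  resolvent set of $A$.\<close>

definition shift_inv :: "'a::complex_banach set \<Rightarrow> ('a \<Rightarrow> 'a) \<Rightarrow> complex \<Rightarrow> 'a \<Rightarrow> 'a"
  where "shift_inv D A z = inv_into D (\<lambda>x. z *\<^sub>C x + A x)"

text \<open>The suprema are taken in the reals. If $i\mathbb{R} \setminus \{0\}$ lies in the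
  resolvent set of $A$, the sets are bounded (and nonempty) in the stated ranges of $s$,
  since the norm of the resolvent is continuous and $|r|$ ranges over a bounded set that
  stays away from zero.\<close>

definition res_M :: "'a::complex_banach set \<Rightarrow> ('a \<Rightarrow> 'a) \<Rightarrow> real \<Rightarrow> real"  \<comment> \<open>for \<open>s \<ge> 1\<close>\<close>
  where "res_M D A s =
    Sup {onorm (shift_inv D A (\<i> * complex_of_real r)) |r. 1 \<le> \<bar>r\<bar> \<and> \<bar>r\<bar> \<le> s}"

definition res_m :: "'a::complex_banach set \<Rightarrow> ('a \<Rightarrow> 'a) \<Rightarrow> real \<Rightarrow> real"  \<comment> \<open>for \<open>0 < s < 1\<close>\<close>
  where "res_m D A s =
    Sup {onorm (shift_inv D A (\<i> * complex_of_real r)) |r. s < \<bar>r\<bar> \<and> \<bar>r\<bar> \<le> 1}"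

text \<open>A right inverse of \<open>f\<close>, with values in the domain \<open>S\<close> of \<open>f\<close>, defined for all
  sufficiently large arguments.\<close>

definition eventual_right_inverse ::
    "real set \<Rightarrow> (real \<Rightarrow> real) \<Rightarrow> (real \<Rightarrow> real) \<Rightarrow> bool"
  where "eventual_right_inverse S f g \<longleftrightarrow> (\<forall>\<^sub>F t in at_top. g t \<in> S \<and> f (g t) = t)"

end

theory Submission
  imports Defs
begin

text \<open>
  Write \<open>K\<close> for a bound of the semigroup and \<open>R\<close> for \<open>(I + A)\<^sup>-\<^sup>1\<close>. A large resolvent norm at a
  point of the imaginary axis produces an approximate eigenvector: if
  \<open>\<parallel>(ir + A)\<^sup>-\<^sup>1\<parallel> > a\<close>, some \<open>x\<close> in the domain has \<open>\<parallel>y\<parallel> < \<parallel>x\<parallel> / a\<close> for \<open>y = (ir + A) x\<close>. Two things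
  follow for such an \<open>x\<close>.

  First, the orbit of \<open>x\<close> moves like \<open>e\<^sup>i\<^sup>r\<^sup>t x\<close> for a long time: \<open>\<parallel>e\<^sup>-\<^sup>z\<^sup>t T(t) x - x\<parallel> \<le> K t \<parallel>(z + A) x\<parallel>\<close>
  whenever \<open>Re z \<ge> 0\<close> (\<open>norm_rescaled_orbit_diff_le\<close>), so with \<open>z = ir\<close>
  the norm of \<open>T(t) x\<close> is at least \<open>\<parallel>x\<parallel> / 2\<close> as long as \<open>2 K t \<le> a\<close>.

  Second, the operator \<open>A R\<^sup>2\<close> acts on \<open>x\<close> almost as the number \<open>-ir / (1 - ir)\<^sup>2\<close>, with an error of
  order \<open>\<parallel>y\<parallel> / \<bar>1 - ir\<bar>\<close> (\<open>A_R_R_approx_eigenvector\<close>). The modulus of that number is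
  comparable to \<open>min \<bar>r\<bar> (1 / \<bar>r\<bar>)\<close>, and it dominates the error once both \<open>a\<close> and \<open>\<bar>r\<bar> a\<close> exceed a
  constant. Together: \<open>\<parallel>T(t) A R\<^sup>2\<parallel> \<ge> min \<bar>r\<bar> (1 / \<bar>r\<bar>) / 8\<close> for all \<open>t\<close> up to a constant times
  \<open>\<parallel>(ir + A)\<^sup>-\<^sup>1\<parallel>\<close> (\<open>lower_bound_at_imag\<close>).

  The theorem results from choosing \<open>r\<close> so that \<open>\<parallel>(ir + A)\<^sup>-\<^sup>1\<parallel>\<close> is at least half of
  \<open>M(s) = 4 K t\<close>, respectively of \<open>m(s) = 4 K t\<close>. In the first case \<open>1 \<le> \<bar>r\<bar> \<le> s\<close>, so the bound is at least
  \<open>1 / (8 s)\<close>. In the second case \<open>s < \<bar>r\<bar> \<le> 1\<close>, so it is at least \<open>s / 8\<close>; here the growth of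
  \<open>\<parallel>s (\<plusminus>is + A)\<^sup>-\<^sup>1\<parallel>\<close> at zero is what makes \<open>\<bar>r\<bar> \<parallel>(ir + A)\<^sup>-\<^sup>1\<parallel>\<close> large, after replacing \<open>r\<close> by \<open>-r\<close> if
  the resolvent is larger there.

  That \<open>R\<close> exists as a bounded operator is part of the Hille--Yosida theory. It follows from the
  same orbit estimate at \<open>z = 1\<close> (boundedness below) and from a Laplace integral over a finite
  interval combined with a contraction argument (\<open>one_plus_A_surj\<close>).
\<close>

section \<open>Complex scalars and difference quotients\<close>

lemma bounded_bilinear_scaleC:
  "bounded_bilinear (scaleC :: complex \<Rightarrow> 'a::complex_normed_vector \<Rightarrow> 'a)"
proof
  fix a b :: complex and x y :: 'a and r :: real
  show "(a + b) *\<^sub>C x = a *\<^sub>C x + b *\<^sub>C x" by (rule scaleC_add_left)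
  show "a *\<^sub>C (x + y) = a *\<^sub>C x + a *\<^sub>C y" by (rule scaleC_add_right)
  show "(r *\<^sub>R a) *\<^sub>C x = r *\<^sub>R (a *\<^sub>C x)"
    by (simp add: scaleR_conv_of_real scaleC_scaleC flip: scaleC_of_real)
  show "a *\<^sub>C (r *\<^sub>R x) = r *\<^sub>R (a *\<^sub>C x)"
    by (simp add: scaleC_scaleC mult.commute flip: scaleC_of_real)
  show "\<exists>K. \<forall>(a::complex) (x::'a). norm (a *\<^sub>C x) \<le> norm a * norm x * K"
    by (rule exI[of _ 1]) (simp add: norm_scaleC)
qed

interpretation scaleC: bounded_bilinear "scaleC :: complex \<Rightarrow> 'a::complex_normed_vector \<Rightarrow> 'a"
  by (rule bounded_bilinear_scaleC)

lemma scaleC_one [simp]: "1 *\<^sub>C (x::'a::complex_normed_vector) = x"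
  using scaleC_of_real[of 1 x] by simp

lemma right_difference_quotient_tendsto:
  assumes "(f has_vector_derivative d) (at_right t)"
  shows "((\<lambda>h. (f (t + h) - f t) /\<^sub>R h) \<longlongrightarrow> d) (at_right 0)"
proof -
  have "((\<lambda>s. (f s - f t - (s - t) *\<^sub>R d) /\<^sub>R norm (s - t)) \<longlongrightarrow> 0) (at_right t)"
    using assms by (simp add: has_vector_derivative_def has_derivative_at_within)
  then have "((\<lambda>h. (f (t + h) - f t - h *\<^sub>R d) /\<^sub>R norm h) \<longlongrightarrow> 0) (at_right 0)"
    by (simp add: at_right_to_0[of t] filterlim_filtermap add.commute)
  moreover have "\<forall>\<^sub>F h in at_right 0. (f (t + h) - f t - h *\<^sub>R d) /\<^sub>R norm h
      = (f (t + h) - f t) /\<^sub>R h - d"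
    by (rule eventually_at_rightI[of 0 1]) (auto simp: scaleR_right_diff_distrib)
  ultimately have "((\<lambda>h. (f (t + h) - f t) /\<^sub>R h - d) \<longlongrightarrow> 0) (at_right 0)"
    using tendsto_cong by force
  then show ?thesis by (simp add: LIM_zero_cancel)
qed

section \<open>Bounded semigroups and their generators\<close>

locale bounded_C0_semigroup =
  fixes T :: "real \<Rightarrow> 'a::complex_banach \<Rightarrow> 'a"
    and D :: "'a set"
    and A :: "'a \<Rightarrow> 'a"
    and K :: real
  assumes semigroup: "C0_semigroup T"
    and generator: "is_generator T D (\<lambda>x. - A x)"
    and K_ge_1: "1 \<le> K"
    and norm_T_le: "0 \<le> t \<Longrightarrow> norm (T t x) \<le> K * norm x"
begin

lemma bounded_linear_T: "0 \<le> t \<Longrightarrow> bounded_linear (T t)"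
  and T_scaleC: "0 \<le> t \<Longrightarrow> T t (a *\<^sub>C x) = a *\<^sub>C T t x"
  and T_0: "T 0 x = x"
  and T_add_time: "0 \<le> s \<Longrightarrow> 0 \<le> t \<Longrightarrow> T (s + t) x = T s (T t x)"
  and T_tendsto: "((\<lambda>t. T t x) \<longlongrightarrow> x) (at_right 0)"
  using semigroup by (auto simp: C0_semigroup_def bounded_clinear_def)

lemmas T_diff = linear_diff[OF bounded_linear.linear[OF bounded_linear_T]]
lemmas T_add = linear_add[OF bounded_linear.linear[OF bounded_linear_T]]
lemmas T_scaleR = linear_cmul[OF bounded_linear.linear[OF bounded_linear_T]]

lemma generator_tendsto:
  "x \<in> D \<Longrightarrow> ((\<lambda>h. (T h x - x) /\<^sub>R h) \<longlongrightarrow> - A x) (at_right 0)"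
  using generator by (auto simp: is_generator_def)

text \<open>The domain consists of all vectors at which the difference quotient converges, so a computed
  limit yields membership in \<open>D\<close> as well as the value of \<open>A\<close>.\<close>

lemma generatorI:
  assumes "((\<lambda>h. (T h x - x) /\<^sub>R h) \<longlongrightarrow> y) (at_right 0)"
  shows "x \<in> D" "A x = - y"
proof -
  show "x \<in> D" using assms generator unfolding is_generator_def by blast
  from tendsto_unique[OF _ generator_tendsto[OF this] assms]
  show "A x = - y" by (metis minus_minus trivial_limit_at_right_real)
qed

lemma A_add:
  assumes "x \<in> D" "y \<in> D" shows "x + y \<in> D" "A (x + y) = A x + A y"
proof -
  have "((\<lambda>h. (T h x - x) /\<^sub>R h + (T h y - y) /\<^sub>R h) \<longlongrightarrow> - A x + - A y) (at_right 0)"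
    by (intro tendsto_add generator_tendsto assms)
  moreover have "\<forall>\<^sub>F h in at_right 0. (T h x - x) /\<^sub>R h + (T h y - y) /\<^sub>R h
      = (T h (x + y) - (x + y)) /\<^sub>R h"
    by (rule eventually_at_rightI[of 0 1]) (auto simp: T_add algebra_simps)
  ultimately have "((\<lambda>h. (T h (x + y) - (x + y)) /\<^sub>R h) \<longlongrightarrow> - A x + - A y) (at_right 0)"
    using tendsto_cong by force
  from generatorI[OF this] show "x + y \<in> D" "A (x + y) = A x + A y" by auto
qed

lemma A_scaleC:
  assumes "x \<in> D" shows "a *\<^sub>C x \<in> D" "A (a *\<^sub>C x) = a *\<^sub>C A x"
proof -
  have "((\<lambda>h. a *\<^sub>C ((T h x - x) /\<^sub>R h)) \<longlongrightarrow> a *\<^sub>C (- A x)) (at_right 0)"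
    by (intro scaleC.tendsto tendsto_const generator_tendsto assms)
  moreover have "\<forall>\<^sub>F h in at_right 0. a *\<^sub>C ((T h x - x) /\<^sub>R h)
      = (T h (a *\<^sub>C x) - a *\<^sub>C x) /\<^sub>R h"
    by (rule eventually_at_rightI[of 0 1])
      (auto simp: T_scaleC scaleC.scaleR_right scaleC.diff_right)
  ultimately have "((\<lambda>h. (T h (a *\<^sub>C x) - a *\<^sub>C x) /\<^sub>R h) \<longlongrightarrow> a *\<^sub>C (- A x)) (at_right 0)"
    using tendsto_cong by force
  from generatorI[OF this] show "a *\<^sub>C x \<in> D" "A (a *\<^sub>C x) = a *\<^sub>C A x"
    by (auto simp: scaleC.minus_right)
qed

lemma A_diff:
  assumes "x \<in> D" "y \<in> D" shows "x - y \<in> D" "A (x - y) = A x - A y"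
  using A_add[OF assms(1) A_scaleC(1)[OF assms(2), of "-1"]]
    A_scaleC(2)[OF assms(2), of "-1"]
  by (auto simp: scaleC.minus_left)

lemma rescaled_generator_tendsto:
  assumes "x \<in> D"
  shows "((\<lambda>h. (exp (- z * complex_of_real h) *\<^sub>C T h x - x) /\<^sub>R h) \<longlongrightarrow> - (z *\<^sub>C x + A x)) (at_right 0)"
proof -
  have "((\<lambda>w. exp (- z * w)) has_field_derivative - z) (at (complex_of_real 0))"
    by (auto intro!: derivative_eq_intros)
  from right_difference_quotient_tendsto[OF has_vector_derivative_real_field[OF this]]
  have e: "((\<lambda>h. (exp (- z * complex_of_real h) - 1) /\<^sub>R h) \<longlongrightarrow> - z) (at_right 0)"
    by simp
  have "((\<lambda>h. exp (- z * complex_of_real h) *\<^sub>C ((T h x - x) /\<^sub>R h)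
      + ((exp (- z * complex_of_real h) - 1) /\<^sub>R h) *\<^sub>C x) \<longlongrightarrow> exp (- z * complex_of_real 0) *\<^sub>C (- A x) + (- z) *\<^sub>C x) (at_right 0)"
    by (intro tendsto_add scaleC.tendsto tendsto_const generator_tendsto assms e tendsto_intros)
  then show ?thesis
    by (simp add: scaleC.minus_left scaleC.diff_left scaleC.scaleR_left scaleC.scaleR_right
        scaleC.diff_right scaleR_right_diff_distrib add.commute)
qed

text \<open>Formally this bounds the integral of \<open>- e\<^sup>-\<^sup>z\<^sup>s T(s) (z x + A x)\<close> over \<open>[0, t]\<close>. The proof is a
  discrete version that uses only the derivative at time zero: by the semigroup law each of \<open>n\<close>
  steps of length \<open>t / n\<close> moves the rescaled orbit by at most \<open>K\<close> times what the first step does, and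
  \<open>n\<close> times the first displacement tends to \<open>t \<parallel>z x + A x\<parallel>\<close>.\<close>

lemma norm_rescaled_orbit_diff_le:
  assumes "x \<in> D" "0 \<le> Re z" "0 \<le> t"
  shows "norm (exp (- z * complex_of_real t) *\<^sub>C T t x - x) \<le> K * t * norm (z *\<^sub>C x + A x)"
proof (cases "t = 0")
  case True
  then show ?thesis by (simp add: T_0)
next
  case False
  with assms have t: "0 < t" by simp
  define \<phi> where "\<phi> t = exp (- z * complex_of_real t) *\<^sub>C T t x" for t
  have step: "norm (\<phi> (s + h) - \<phi> s) \<le> K * norm (\<phi> h - x)" if "0 \<le> s" "0 \<le> h" for s h
  proof -
    have "\<phi> (s + h) - \<phi> s = exp (- z * complex_of_real s) *\<^sub>C T s (\<phi> h - x)"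
      using that T_add_time[OF that, of x]
      by (simp add: \<phi>_def T_diff T_scaleC scaleC.diff_right scaleC_scaleC distrib_left
          exp_diff exp_minus exp_add divide_inverse mult.commute)
    moreover have "cmod (exp (- z * complex_of_real s)) \<le> 1"
      using that assms by simp
    ultimately have "norm (\<phi> (s + h) - \<phi> s) \<le> 1 * norm (T s (\<phi> h - x))"
      unfolding norm_scaleC by (metis mult_right_mono norm_ge_zero norm_scaleC)
    also have "\<dots> \<le> K * norm (\<phi> h - x)" using norm_T_le[OF that(1)] by simp
    finally show ?thesis .
  qed
  have iter: "norm (\<phi> (of_nat n * h) - x) \<le> of_nat n * (K * norm (\<phi> h - x))" if "0 \<le> h" for n h
  proof (induction n)
    case 0
    then show ?case by (simp add: \<phi>_def T_0)
  next
    case (Suc n)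
    have "norm (\<phi> (of_nat n * h + h) - \<phi> (of_nat n * h)) \<le> K * norm (\<phi> h - x)"
      using that by (intro step) auto
    with Suc show ?case
      using norm_triangle_le_diff[of "\<phi> (of_nat n * h + h) - x" "\<phi> (of_nat n * h) - x"]
        norm_triangle_ineq[of "\<phi> (of_nat n * h + h) - \<phi> (of_nat n * h)" "\<phi> (of_nat n * h) - x"]
      by (simp add: algebra_simps)
  qed
  have "filterlim (\<lambda>n. t / of_nat (Suc n)) (at_right 0) sequentially"
    unfolding filterlim_at
    using t LIMSEQ_Suc[OF lim_const_over_n[of t]] by (auto intro!: always_eventually)
  then have "((\<lambda>n. (\<phi> (t / of_nat (Suc n)) - x) /\<^sub>R (t / of_nat (Suc n))) \<longlongrightarrow> - (z *\<^sub>C x + A x)) sequentially"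
    using filterlim_compose[OF rescaled_generator_tendsto[OF assms(1), of z]]
    unfolding \<phi>_def by blast
  then have "((\<lambda>n. K * t * norm ((\<phi> (t / of_nat (Suc n)) - x) /\<^sub>R (t / of_nat (Suc n)))) \<longlongrightarrow> K * t * norm (- (z *\<^sub>C x + A x))) sequentially"
    by (intro tendsto_intros)
  moreover have "norm (\<phi> t - x) \<le> K * t * norm ((\<phi> (t / of_nat (Suc n)) - x) /\<^sub>R (t / of_nat (Suc n)))" for n
  proof -
    have "norm ((\<phi> (t / of_nat (Suc n)) - x) /\<^sub>R (t / of_nat (Suc n)))
        = of_nat (Suc n) / t * norm (\<phi> (t / of_nat (Suc n)) - x)"
      using t by (simp del: of_nat_Suc)
    then show ?thesis
      using iter[of "t / of_nat (Suc n)" "Suc n"] t by (simp add: mult_ac del: of_nat_Suc)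
  qed
  ultimately have "norm (\<phi> t - x) \<le> K * t * norm (- (z *\<^sub>C x + A x))"
    by (intro tendsto_lowerbound[OF _ always_eventually trivial_limit_sequentially]) auto
  then show ?thesis by (simp add: \<phi>_def norm_minus_commute) (metis add.commute minus_add_distrib norm_minus_cancel)
qed

section \<open>The resolvent at minus one\<close>

text \<open>Right continuity at zero spreads to all times, uniformly and in both directions, because
  \<open>T(b) x - T(a) x = T(a) (T(b - a) x - x)\<close> and \<open>T(a)\<close> is bounded by \<open>K\<close>.\<close>

lemma continuous_on_orbit: "continuous_on {0..} (\<lambda>t. T t x)"
  unfolding continuous_on_iff
proof (intro ballI allI impI)
  fix t e :: real assume t: "t \<in> {0..}" and e: "0 < e"
  from tendstoD[OF T_tendsto, of "e / K" x] e K_ge_1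
  have "\<forall>\<^sub>F h in at_right 0. dist (T h x) x < e / K" by simp
  then obtain d where d: "d > 0" "\<And>h. 0 < h \<Longrightarrow> h < d \<Longrightarrow> dist (T h x) x < e / K"
    unfolding eventually_at_right_field by auto
  have *: "dist (T b x) (T a x) < e" if "0 \<le> a" "a \<le> b" "b - a < d" for a b
  proof (cases "a = b")
    case False
    have "T b x - T a x = T a (T (b - a) x - x)"
      using that T_add_time[of a "b - a" x] by (simp add: T_diff)
    then have "dist (T b x) (T a x) \<le> K * dist (T (b - a) x) x"
      using norm_T_le[OF that(1)] by (simp add: dist_norm)
    also have "\<dots> < e" using d(2)[of "b - a"] False that K_ge_1 by (simp add: field_simps)
    finally show ?thesis .
  qed (use e in auto)
  show "\<exists>d>0. \<forall>t'\<in>{0..}. dist t' t < d \<longrightarrow> dist (T t' x) (T t x) < e"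
  proof (intro exI[of _ d] conjI ballI impI d(1))
    fix t' assume "t' \<in> {0..}" "dist t' t < d"
    then show "dist (T t' x) (T t x) < e"
      using *[of t t'] *[of t' t] t by (cases "t \<le> t'") (auto simp: dist_commute dist_real_def)
  qed
qed

text \<open>The witness is the integral of \<open>e\<^sup>-\<^sup>t T(t) x\<close> over \<open>[0, \<tau>]\<close>. Applying \<open>e\<^sup>-\<^sup>h T(h)\<close> shifts the
  interval of integration by \<open>h\<close>, so the difference quotient only sees the two ends, where the
  integrand takes the values \<open>e\<^sup>-\<^sup>\<tau> T(\<tau>) x\<close> and \<open>x\<close>.\<close>

lemma finite_Laplace_integral:
  assumes "0 \<le> \<tau>"
  shows "\<exists>u\<in>D. u + A u = x - exp (- \<tau>) *\<^sub>R T \<tau> x"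
proof -
  define S where "S t = exp (- t) *\<^sub>R T t x" for t
  define u where "u = integral {0..\<tau>} S"
  define F where "F t = integral {0..t} S" for t
  have cont: "continuous_on {0..} S"
    unfolding S_def by (intro continuous_intros continuous_on_orbit)
  have int: "S integrable_on {a..b}" if "0 \<le> a" for a b
    using that by (intro integrable_continuous_real continuous_on_subset[OF cont]) auto
  have F_tendsto: "((\<lambda>h. (F (t + h) - F t) /\<^sub>R h) \<longlongrightarrow> S t) (at_right 0)" if "0 \<le> t" for t
  proof -
    have "(F has_vector_derivative S t) (at t within {0..t+1})"
      unfolding F_def using that
      by (intro integral_has_vector_derivative continuous_on_subset[OF cont]) auto
    then have "(F has_vector_derivative S t) (at t within {t..t+1})"
      by (rule has_vector_derivative_within_subset) (use that in auto)
    then show ?thesis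
      by (intro right_difference_quotient_tendsto) (simp add: at_within_Icc_at_right)
  qed
  have shift: "exp (- h) *\<^sub>R T h u = F (\<tau> + h) - F h" if "0 \<le> h" for h
  proof -
    have "exp (- h) *\<^sub>R T h u = integral {0..\<tau>} (\<lambda>t. exp (- h) *\<^sub>R T h (S t))"
      unfolding u_def
      using integral_linear[OF int bounded_linear_T[OF that], of 0 \<tau>] by (simp add: o_def)
    also have "\<dots> = integral {0..\<tau>} (\<lambda>t. S (t + h))"
      by (intro integral_cong)
        (use that T_add_time[of h] in \<open>auto simp: S_def T_scaleR exp_add field_simps exp_diff exp_minus add.commute\<close>)
    also have "\<dots> = integral {h..\<tau> + h} S"
      using integral_shift_real_ivl[of h h "\<tau> + h" S] by simp
    also have "\<dots> = F (\<tau> + h) - F h"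
      using Henstock_Kurzweil_Integration.integral_combine[of 0 h "\<tau> + h" S] int assms that
      unfolding F_def by (simp add: algebra_simps)
    finally show ?thesis .
  qed
  have "((\<lambda>h. exp h) has_vector_derivative (1::real)) (at 0 within {0<..})"
    by (auto intro!: derivative_eq_intros simp: has_vector_derivative_def)
  from right_difference_quotient_tendsto[OF this]
  have e: "((\<lambda>h::real. (exp h - 1) / h) \<longlongrightarrow> 1) (at_right 0)"
    by (simp add: divide_inverse_commute)
  have "((\<lambda>h. exp h *\<^sub>R ((F (\<tau> + h) - F \<tau>) /\<^sub>R h - (F (0 + h) - F 0) /\<^sub>R h)
      + ((exp h - 1) / h) *\<^sub>R u) \<longlongrightarrow> exp 0 *\<^sub>R (S \<tau> - S 0) + 1 *\<^sub>R u) (at_right 0)"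
    by (intro tendsto_intros F_tendsto e assms order_refl)
  moreover have "\<forall>\<^sub>F h in at_right 0. exp h *\<^sub>R ((F (\<tau> + h) - F \<tau>) /\<^sub>R h - (F (0 + h) - F 0) /\<^sub>R h)
      + ((exp h - 1) / h) *\<^sub>R u = (T h u - u) /\<^sub>R h"
  proof (rule eventually_at_rightI[of 0 1])
    fix h :: real assume h: "h \<in> {0<..<1}"
    have Thu: "T h u = exp h *\<^sub>R (F (\<tau> + h) - F h)"
      using h by (simp add: shift[symmetric] exp_minus)
    have F: "F \<tau> = u" "F 0 = 0" by (simp_all add: F_def u_def)
    show "exp h *\<^sub>R ((F (\<tau> + h) - F \<tau>) /\<^sub>R h - (F (0 + h) - F 0) /\<^sub>R h)
      + ((exp h - 1) / h) *\<^sub>R u = (T h u - u) /\<^sub>R h"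
      unfolding Thu F by (simp add: algebra_simps divide_inverse)
  qed simp
  ultimately have "((\<lambda>h. (T h u - u) /\<^sub>R h) \<longlongrightarrow> S \<tau> - x + u) (at_right 0)"
    using tendsto_cong by (force simp: S_def T_0)
  from generatorI[OF this] show ?thesis by (intro bexI[of _ u]) (auto simp: S_def)
qed

lemma exists_contractive_time: "\<exists>\<tau>\<ge>0. K * exp (- \<tau>) \<le> 1 / 2"
  using K_ge_1 by (intro exI[of _ "ln (2 * K)"]) (simp add: exp_minus)

definition R :: "'a \<Rightarrow> 'a" where "R = shift_inv D A 1"

text \<open>For large \<open>\<tau>\<close> the operator \<open>e\<^sup>-\<^sup>\<tau> T(\<tau>)\<close> is a strict contraction, so \<open>I - e\<^sup>-\<^sup>\<tau> T(\<tau>)\<close> is onto by the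
  fixed point theorem, and its range lies in the range of \<open>I + A\<close>. This avoids an integral over
  an unbounded interval.\<close>

lemma one_plus_A_surj: "\<exists>u\<in>D. u + A u = z"
proof -
  obtain \<tau> where \<tau>: "0 \<le> \<tau>" "K * exp (- \<tau>) \<le> 1 / 2"
    using exists_contractive_time by blast
  have "\<exists>!x. z + exp (- \<tau>) *\<^sub>R T \<tau> x = x"
  proof (rule banach_fix_type[where c = "1 / 2"], goal_cases)
    case 3
    show ?case
    proof (intro allI)
      fix x y :: 'a
      have "norm (exp (- \<tau>) *\<^sub>R T \<tau> (x - y)) \<le> exp (- \<tau>) * (K * norm (x - y))"
        using norm_T_le[OF \<tau>(1), of "x - y"] by simp
      also have "\<dots> \<le> 1 / 2 * norm (x - y)"
        using mult_right_mono[OF \<tau>(2), of "norm (x - y)"] by (simp add: mult_ac)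
      finally show "dist (z + exp (- \<tau>) *\<^sub>R T \<tau> x) (z + exp (- \<tau>) *\<^sub>R T \<tau> y) \<le> 1 / 2 * dist x y"
        by (simp add: dist_norm T_diff \<tau> scaleR_right_diff_distrib)
    qed
  qed auto
  then obtain x where "z + exp (- \<tau>) *\<^sub>R T \<tau> x = x" by blast
  then have "z = x - exp (- \<tau>) *\<^sub>R T \<tau> x" by (simp add: algebra_simps)
  with finite_Laplace_integral[OF \<tau>(1), of x] show ?thesis by simp
qed

text \<open>The same contraction makes the orbit estimate at \<open>z = 1\<close> absorb half of \<open>\<parallel>u\<parallel>\<close>.\<close>

lemma one_plus_A_bounded_below: "\<exists>C\<ge>0. \<forall>u\<in>D. norm u \<le> C * norm (u + A u)"
proof -
  obtain \<tau> where \<tau>: "0 \<le> \<tau>" "K * exp (- \<tau>) \<le> 1 / 2"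
    using exists_contractive_time by blast
  have "norm u \<le> 2 * K * \<tau> * norm (u + A u)" if "u \<in> D" for u
  proof -
    have exp_real: "exp (- 1 * complex_of_real \<tau>) *\<^sub>C T \<tau> u = exp (- \<tau>) *\<^sub>R T \<tau> u"
      by (simp flip: exp_of_real scaleC_of_real)
    have "norm (exp (- \<tau>) *\<^sub>R T \<tau> u - u) \<le> K * \<tau> * norm (u + A u)"
      using norm_rescaled_orbit_diff_le[OF that, of 1 \<tau>] \<tau> unfolding exp_real by simp
    moreover have "norm (exp (- \<tau>) *\<^sub>R T \<tau> u) \<le> 1 / 2 * norm u"
    proof -
      have "norm (exp (- \<tau>) *\<^sub>R T \<tau> u) \<le> exp (- \<tau>) * (K * norm u)"
        using norm_T_le[OF \<tau>(1), of u] by simp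
      also have "\<dots> \<le> 1 / 2 * norm u"
        using mult_right_mono[OF \<tau>(2), of "norm u"] by (simp add: mult_ac)
      finally show ?thesis .
    qed
    ultimately show ?thesis
      using norm_triangle_ineq2[of u "exp (- \<tau>) *\<^sub>R T \<tau> u"]
      by (simp add: norm_minus_commute)
  qed
  then show ?thesis using \<tau> K_ge_1 by (intro exI[of _ "2 * K * \<tau>"]) auto
qed

lemma one_plus_A_bij: "bij_betw (\<lambda>x. 1 *\<^sub>C x + A x) D UNIV"
proof -
  obtain C where C: "\<And>u. u \<in> D \<Longrightarrow> norm u \<le> C * norm (u + A u)"
    using one_plus_A_bounded_below by blast
  have "x = y" if "x \<in> D" "y \<in> D" "x + A x = y + A y" for x y
    using C[OF A_diff(1)[OF that(1,2)]] that(3) A_diff(2)[OF that(1,2)]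
    by (simp add: algebra_simps)
  then show ?thesis
    using one_plus_A_surj by (auto simp: bij_betw_def inj_on_def image_iff) metis
qed

lemma R_in_D: "R x \<in> D"
  and R_right_inverse: "R x + A (R x) = x"
  using inv_into_into[of x "\<lambda>x. 1 *\<^sub>C x + A x" D] f_inv_into_f[of x "\<lambda>x. 1 *\<^sub>C x + A x" D]
    one_plus_A_bij
  by (auto simp: R_def shift_inv_def bij_betw_def)

lemma R_eqI: "u \<in> D \<Longrightarrow> u + A u = x \<Longrightarrow> R x = u"
  using inv_into_f_eq[OF bij_betw_imp_inj_on[OF one_plus_A_bij], of u x]
  by (simp add: R_def shift_inv_def)

lemma R_add: "R (x + y) = R x + R y"
  by (rule R_eqI)
    (use A_add[OF R_in_D R_in_D, of x y] R_right_inverse[of x] R_right_inverse[of y]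
      in \<open>simp_all add: algebra_simps\<close>)

lemma R_scaleC: "R (a *\<^sub>C x) = a *\<^sub>C R x"
  by (rule R_eqI)
    (use A_scaleC[OF R_in_D, of a x] R_right_inverse[of x]
      in \<open>simp_all flip: scaleC.add_right\<close>)

lemma bounded_linear_R: "bounded_linear R"
proof -
  obtain C where C: "\<And>u. u \<in> D \<Longrightarrow> norm u \<le> C * norm (u + A u)"
    using one_plus_A_bounded_below by blast
  have "norm (R x) \<le> norm x * C" for x
    using C[OF R_in_D, of x] by (simp add: R_right_inverse mult.commute)
  then show ?thesis
    using R_scaleC[of "complex_of_real _"]
    by (intro bounded_linear_intro R_add) (auto simp: scaleC_of_real)
qed

lemma A_R_R: "A (R (R x)) = R x - R (R x)"
  using R_right_inverse[of "R x"] by (simp add: algebra_simps)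

section \<open>Lower bounds from approximate eigenvectors\<close>

text \<open>If \<open>A x = -ir x\<close> exactly, then \<open>R x = \<mu> x\<close> and \<open>A R\<^sup>2 x = (R - R\<^sup>2) x = (\<mu> - \<mu>\<^sup>2) x\<close>. The error term
  keeps a factor \<open>\<mu>\<close> in front, which matters for large \<open>r\<close>: there \<open>\<mu> - \<mu>\<^sup>2\<close> itself is only of
  order \<open>1 / r\<close>.\<close>

lemma A_R_R_approx_eigenvector:
  assumes "x \<in> D" and y: "(\<i> * complex_of_real r) *\<^sub>C x + A x = y"
    and \<mu>: "\<mu> = 1 / (1 - \<i> * complex_of_real r)"
  shows "A (R (R x)) = (\<mu> - \<mu>\<^sup>2) *\<^sub>C x - \<mu> *\<^sub>C (R y - \<mu> *\<^sub>C R y - R (R y))"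
proof -
  have nz: "1 - \<i> * complex_of_real r \<noteq> 0" by (simp add: complex_eq_iff)
  have "x = R ((1 - \<i> * complex_of_real r) *\<^sub>C x + y)"
    using assms by (intro R_eqI[symmetric]) (auto simp: scaleC.diff_left)
  also have "\<dots> = (1 - \<i> * complex_of_real r) *\<^sub>C R x + R y"
    by (simp add: R_add R_scaleC)
  finally have "\<mu> *\<^sub>C x = \<mu> *\<^sub>C ((1 - \<i> * complex_of_real r) *\<^sub>C R x + R y)" by simp
  then have Rx: "R x = \<mu> *\<^sub>C x - \<mu> *\<^sub>C R y"
    using nz by (simp add: scaleC.add_right scaleC_scaleC \<mu>)
  have "R (R x) = \<mu> *\<^sub>C R x - \<mu> *\<^sub>C R (R y)"
    by (subst Rx)
      (simp add: linear_diff[OF bounded_linear.linear[OF bounded_linear_R]] R_scaleC)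
  then have "A (R (R x)) = R x - (\<mu> *\<^sub>C R x - \<mu> *\<^sub>C R (R y))"
    using A_R_R[of x] by simp
  then show ?thesis
    by (simp add: Rx scaleC.diff_right scaleC.diff_left scaleC_scaleC power2_eq_square)
qed

lemma bounded_linear_T_A_R_R: "0 \<le> t \<Longrightarrow> bounded_linear (\<lambda>x. T t (A (R (R x))))"
  unfolding A_R_R
  by (intro bounded_linear_compose[OF bounded_linear_T] bounded_linear_sub bounded_linear_R
      bounded_linear_compose[OF bounded_linear_R])

text \<open>The resolvent set is stated for \<open>z - A\<close> and \<open>shift_inv\<close> inverts \<open>z + A\<close>; the two are related by
  changing the signs of \<open>z\<close> and of the argument.\<close>

lemma shift_inv_imag:
  assumes "- \<i> * complex_of_real r \<in> op_resolvent_set D A"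
  defines "S \<equiv> shift_inv D A (\<i> * complex_of_real r)"
  shows "S y \<in> D" "(\<i> * complex_of_real r) *\<^sub>C S y + A (S y) = y" "bounded_linear S"
proof -
  define z where "z = \<i> * complex_of_real r"
  define f where "f = (\<lambda>x. (- z) *\<^sub>C x - A x)"
  have f: "bij_betw f D UNIV" "bounded_linear (inv_into D f)"
    using assms(1) by (auto simp: op_resolvent_set_def bounded_clinear_def f_def z_def)
  have neg: "z *\<^sub>C x + A x = - f x" for x by (simp add: f_def scaleC.minus_left)
  have inD: "inv_into D f y \<in> D" and inv: "f (inv_into D f y) = y" for y
    using f(1) by (auto simp: bij_betw_def inv_into_into f_inv_into_f)
  have bij: "bij_betw (\<lambda>x. - f x) D UNIV"
    using bij_betw_trans[OF f(1) bij_uminus] by (simp add: o_def)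
  have S: "S = (\<lambda>y. inv_into D f (- y))"
  proof
    fix y show "S y = inv_into D f (- y)"
      unfolding S_def shift_inv_def z_def[symmetric] neg
      by (rule inv_into_f_eq) (use bij inD inv in \<open>auto simp: bij_betw_def\<close>)
  qed
  show "S y \<in> D" by (simp add: S inD)
  show "(\<i> * complex_of_real r) *\<^sub>C S y + A (S y) = y"
    unfolding z_def[symmetric] neg by (simp add: S inv)
  show "bounded_linear S"
    unfolding S by (intro bounded_linear_compose[OF f(2)] bounded_linear_minus bounded_linear_ident)
qed

text \<open>The three lower bounds on \<open>L\<close> serve different ends: \<open>2 K t < L\<close> keeps the orbit of the
  approximate eigenvector long up to time \<open>t\<close>, while \<open>8 C < L\<close> and \<open>8 C < \<bar>r\<bar> L\<close> make
  the error at most half of the leading term, for large and for small \<open>\<bar>r\<bar>\<close> respectively.\<close>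

lemma lower_bound_at_imag:
  assumes bdd: "C \<ge> 0" "\<And>\<mu> y t. cmod \<mu> \<le> 1 \<Longrightarrow> 0 \<le> t \<Longrightarrow> norm (T t (R y - \<mu> *\<^sub>C R y - R (R y))) \<le> C * norm y"
    and res: "- \<i> * complex_of_real r \<in> op_resolvent_set D A"
    and "r \<noteq> 0" "0 \<le> t"
    and L: "L = onorm (shift_inv D A (\<i> * complex_of_real r))"
      "2 * K * t < L" "8 * C < L" "8 * C < \<bar>r\<bar> * L"
  shows "min \<bar>r\<bar> (1 / \<bar>r\<bar>) / 8 \<le> onorm (\<lambda>x. T t (A (R (R x))))"
proof -
  define S where "S = shift_inv D A (\<i> * complex_of_real r)"
  note S = shift_inv_imag[OF res, folded S_def]
  \<comment> \<open>One threshold below \<open>L\<close> that gives all three bounds, so that a single vector serves for each.\<close>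
  define a where "a = Max {2 * K * t, 8 * C, 8 * C / \<bar>r\<bar>}"
  have "a < L" using assms by (simp add: a_def field_simps)
  have a: "2 * K * t \<le> a" "8 * C \<le> a" "8 * C / \<bar>r\<bar> \<le> a" by (auto simp: a_def)
  have a_nonneg: "0 \<le> a" using a(2) bdd(1) by linarith
  obtain y where y: "a * norm y < norm (S y)"
    using onorm_bound[OF a_nonneg, of S] \<open>a < L\<close> L(1) by (force simp: S_def not_less[symmetric])
  define x where "x = S y"
  have x: "x \<in> D" "(\<i> * complex_of_real r) *\<^sub>C x + A x = y" "a * norm y < norm x"
    using S(1,2) y by (auto simp: x_def)
  define \<mu> where "\<mu> = 1 / (1 - \<i> * complex_of_real r)"
  define q where "q = sqrt (1 + r\<^sup>2)"
  have q: "1 \<le> q" "q\<^sup>2 = 1 + r\<^sup>2" "\<bar>r\<bar> \<le> q" by (auto simp: q_def real_le_rsqrt)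
  have cmod: "cmod (1 - \<i> * complex_of_real r) = q" by (simp add: cmod_def q_def)
  have mu: "cmod \<mu> = 1 / q" by (simp add: \<mu>_def norm_divide cmod)
  have nz: "1 - \<i> * complex_of_real r \<noteq> 0" by (simp add: complex_eq_iff)
  have "1 / w - (1 / w)\<^sup>2 = (w - 1) / w\<^sup>2" if "w \<noteq> 0" for w :: complex
    using that by (simp add: field_simps power2_eq_square)
  from this[OF nz] have "\<mu> - \<mu>\<^sup>2 = - \<i> * complex_of_real r / (1 - \<i> * complex_of_real r)\<^sup>2"
    by (simp add: \<mu>_def)
  then have mu2: "cmod (\<mu> - \<mu>\<^sup>2) = \<bar>r\<bar> / q\<^sup>2"
    by (simp add: norm_divide norm_mult norm_power cmod)
  have orbit: "norm x / 2 \<le> norm (T t x)"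
  proof -
    have unit: "cmod (exp (- (\<i> * complex_of_real r) * complex_of_real t)) = 1" by simp
    have "norm (exp (- (\<i> * complex_of_real r) * complex_of_real t) *\<^sub>C T t x - x) \<le> K * t * norm y"
      using norm_rescaled_orbit_diff_le[OF x(1), of "\<i> * complex_of_real r" t] \<open>0 \<le> t\<close> x(2) by simp
    then have "norm x - norm (T t x) \<le> K * t * norm y"
      using norm_triangle_ineq2[of x "exp (- (\<i> * complex_of_real r) * complex_of_real t) *\<^sub>C T t x"]
      unfolding norm_scaleC unit by (simp add: norm_minus_commute)
    moreover have "2 * K * t * norm y \<le> a * norm y" using a by (intro mult_right_mono) auto
    ultimately show ?thesis using x(3) by simp
  qed
  have "cmod \<mu> \<le> 1" using q by (simp add: mu)
  then have err: "norm (T t (\<mu> *\<^sub>C (R y - \<mu> *\<^sub>C R y - R (R y)))) \<le> 1 / q * (C * norm y)"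
    using bdd(2)[of \<mu> t y] q \<open>0 \<le> t\<close>
    by (simp add: T_scaleC norm_scaleC mu divide_right_mono)
  have err2: "1 / q * (C * norm y) \<le> \<bar>r\<bar> / (4 * q\<^sup>2) * norm x"
  proof -
    have "4 * q * C \<le> \<bar>r\<bar> * a"
    proof (cases "\<bar>r\<bar> \<le> 1")
      case True
      then have "r\<^sup>2 \<le> 1" by (simp add: abs_square_le_1)
      then have "q \<le> 2" unfolding q_def by (intro real_le_lsqrt) auto
      then have "4 * q * C \<le> 8 * C" using bdd(1) by (intro mult_right_mono) auto
      also have "\<dots> \<le> \<bar>r\<bar> * a" using a(3) \<open>r \<noteq> 0\<close> by (simp add: field_simps)
      finally show ?thesis .
    next
      case False
      then have "1 \<le> r\<^sup>2" by (metis abs_le_square_iff abs_one linear one_power2)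
      then have "q \<le> 2 * \<bar>r\<bar>" unfolding q_def by (intro real_le_lsqrt) (auto simp: power_mult_distrib)
      then have "4 * q * C \<le> 4 * (2 * \<bar>r\<bar>) * C" using bdd(1) by (intro mult_right_mono) auto
      also have "\<dots> = \<bar>r\<bar> * (8 * C)" by simp
      also have "\<dots> \<le> \<bar>r\<bar> * a" using a(2) by (intro mult_left_mono) auto
      finally show ?thesis .
    qed
    then have "4 * q * C * norm y \<le> \<bar>r\<bar> * (a * norm y)"
      by (metis mult.assoc mult_right_mono norm_ge_zero)
    also have "\<dots> \<le> \<bar>r\<bar> * norm x" using x(3) by (intro mult_left_mono) auto
    finally show ?thesis using q(1) by (simp add: field_simps power2_eq_square)
  qed
  have "\<bar>r\<bar> / q\<^sup>2 * (norm x / 2) \<le> \<bar>r\<bar> / q\<^sup>2 * norm (T t x)"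
    using orbit by (intro mult_left_mono) auto
  also have "\<dots> = norm (T t ((\<mu> - \<mu>\<^sup>2) *\<^sub>C x))"
    using \<open>0 \<le> t\<close> by (simp add: T_scaleC norm_scaleC mu2)
  also have "\<dots> \<le> norm (T t (A (R (R x)))) + norm (T t (\<mu> *\<^sub>C (R y - \<mu> *\<^sub>C R y - R (R y))))"
    unfolding A_R_R_approx_eigenvector[OF x(1,2) \<mu>_def] T_diff[OF \<open>0 \<le> t\<close>, of "(\<mu> - \<mu>\<^sup>2) *\<^sub>C x"]
    by (metis add.commute norm_triangle_sub)
  finally have "\<bar>r\<bar> / (4 * q\<^sup>2) * norm x \<le> norm (T t (A (R (R x))))"
    using err err2 by (simp add: field_simps)
  also have "\<dots> \<le> onorm (\<lambda>x. T t (A (R (R x)))) * norm x"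
    by (rule onorm[OF bounded_linear_T_A_R_R[OF \<open>0 \<le> t\<close>]])
  finally have "\<bar>r\<bar> / (4 * q\<^sup>2) \<le> onorm (\<lambda>x. T t (A (R (R x))))"
    using x(3) a_nonneg by (smt (verit) mult_nonneg_nonneg mult_right_le_imp_le norm_ge_zero)
  moreover have "min \<bar>r\<bar> (1 / \<bar>r\<bar>) / 8 \<le> \<bar>r\<bar> / (4 * q\<^sup>2)"
  proof (cases "\<bar>r\<bar> \<le> 1")
    case True
    then have "q\<^sup>2 \<le> 2" unfolding q(2) by (simp add: abs_square_le_1)
    then have "\<bar>r\<bar> / 8 \<le> \<bar>r\<bar> / (4 * q\<^sup>2)" using q(1) by (intro divide_left_mono) auto
    then show ?thesis by (auto simp: min_def)
  next
    case False
    then have "1 \<le> r\<^sup>2" by (metis abs_le_square_iff abs_one linear one_power2)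
    then have "1 / \<bar>r\<bar> / 8 \<le> \<bar>r\<bar> / (4 * q\<^sup>2)"
      using \<open>r \<noteq> 0\<close> unfolding q(2) by (simp add: field_simps power2_eq_square) 
    then show ?thesis by (auto simp: min_def)
  qed
  ultimately show ?thesis by linarith
qed

lemma exists_error_constant:
  "\<exists>C\<ge>0. \<forall>\<mu> y t. cmod \<mu> \<le> 1 \<longrightarrow> 0 \<le> t \<longrightarrow> norm (T t (R y - \<mu> *\<^sub>C R y - R (R y))) \<le> C * norm y"
proof -
  obtain B where B: "B \<ge> 0" "\<And>x. norm (R x) \<le> norm x * B"
    using bounded_linear.nonneg_bounded[OF bounded_linear_R] by blast
  have "norm (T t (R y - \<mu> *\<^sub>C R y - R (R y))) \<le> K * (2 * B + B * B) * norm y"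
    if "cmod \<mu> \<le> 1" "0 \<le> t" for \<mu> y t
  proof -
    have "norm (R y - \<mu> *\<^sub>C R y - R (R y)) \<le> norm (R y) + norm (\<mu> *\<^sub>C R y) + norm (R (R y))"
      by (meson add_right_mono norm_triangle_ineq4 order_trans)
    moreover have "norm (\<mu> *\<^sub>C R y) \<le> norm (R y)"
      using that(1) by (simp add: norm_scaleC mult_left_le_one_le)
    moreover have "norm (R (R y)) \<le> norm y * B * B"
      using B(2)[of "R y"] mult_right_mono[OF B(2)[of y] B(1)] by linarith
    ultimately have "norm (R y - \<mu> *\<^sub>C R y - R (R y)) \<le> (2 * B + B * B) * norm y"
      using B(2)[of y] by (simp add: algebra_simps)
    then have "K * norm (R y - \<mu> *\<^sub>C R y - R (R y)) \<le> K * ((2 * B + B * B) * norm y)"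
      using K_ge_1 by (intro mult_left_mono) auto
    with norm_T_le[OF that(2), of "R y - \<mu> *\<^sub>C R y - R (R y)"]
    show ?thesis by (simp only: mult.assoc)
  qed
  then show ?thesis using B K_ge_1 by (intro exI[of _ "K * (2 * B + B * B)"]) auto
qed

end

section \<open>From the suprema to points of the imaginary axis\<close>

text \<open>For a set that is not bounded above, the supremum of reals is an arbitrary number, but then
  every number is exceeded by some element.\<close>

lemma exists_greater_if_less_Sup:
  fixes X :: "real set"
  assumes "X \<noteq> {}" "a < Sup X"
  shows "\<exists>x\<in>X. a < x"
proof (cases "bdd_above X")
  case True
  then show ?thesis using less_cSup_iff assms by blast
next
  case False
  then show ?thesis by (meson bdd_aboveI not_le_imp_less)
qed

lemma exists_res_M_witness:
  assumes "1 \<le> s" "a < res_M D A s"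
  shows "\<exists>r. 1 \<le> \<bar>r\<bar> \<and> \<bar>r\<bar> \<le> s \<and> a < onorm (shift_inv D A (\<i> * complex_of_real r))"
  using exists_greater_if_less_Sup[OF _ assms(2)[unfolded res_M_def]] assms(1)
  by (force intro: exI[of _ 1])

lemma exists_res_m_witness:
  assumes "s < 1" "a < res_m D A s"
  shows "\<exists>r. s < \<bar>r\<bar> \<and> \<bar>r\<bar> \<le> 1 \<and> a < onorm (shift_inv D A (\<i> * complex_of_real r))"
  using exists_greater_if_less_Sup[OF _ assms(2)[unfolded res_m_def]] assms(1)
  by (force intro: exI[of _ 1])

section \<open>The lower bound on the decay rate\<close>

theorem corollary8p2:
  fixes T :: "real \<Rightarrow> 'a::complex_banach \<Rightarrow> 'a"
    and D :: "'a set"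
    and A :: "'a \<Rightarrow> 'a"
    and Minv minv :: "real \<Rightarrow> real"
  assumes "C0_semigroup T"
    and "bounded_semigroup T"
    and "is_generator T D (\<lambda>x. - A x)"
    and "op_spectrum D A \<inter> {z. Re z = 0} = {0}"
    and "filterlim
           (\<lambda>s::real. max (onorm (\<lambda>x. s *\<^sub>R shift_inv D A (\<i> * complex_of_real s) x))
                          (onorm (\<lambda>x. s *\<^sub>R shift_inv D A (- \<i> * complex_of_real s) x)))
           at_top (at 0)"
    and "filterlim (res_M D A) at_top at_top"
    and "eventual_right_inverse {1..} (res_M D A) Minv"
    and "eventual_right_inverse {0<..<1} (res_m D A) minv"
  shows "\<exists>c>0. \<exists>c'>0. \<exists>C'>0. \<forall>\<^sub>F t in at_top.
           onorm (\<lambda>x. T t (A (shift_inv D A 1 (shift_inv D A 1 x))))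
             \<ge> c * max (minv (c' * t)) (1 / Minv (C' * t))"
proof -
  obtain K0 where K0: "\<And>t. 0 \<le> t \<Longrightarrow> onorm (T t) \<le> K0"
    using assms(2) by (auto simp: bounded_semigroup_def)
  define K where "K = max 1 K0"
  interpret bounded_C0_semigroup T D A K
  proof
    fix t :: real and x :: 'a assume "0 \<le> t"
    then have "bounded_linear (T t)"
      using assms(1) by (auto simp: C0_semigroup_def bounded_clinear_def)
    from onorm[OF this, of x] have "norm (T t x) \<le> onorm (T t) * norm x" .
    also have "\<dots> \<le> K * norm x"
      using K0[OF \<open>0 \<le> t\<close>] by (intro mult_right_mono) (auto simp: K_def)
    finally show "norm (T t x) \<le> K * norm x" .
  qed (use assms in \<open>auto simp: K_def\<close>)
  obtain C where C: "C \<ge> 0"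
      "\<And>\<mu> y t. cmod \<mu> \<le> 1 \<Longrightarrow> 0 \<le> t \<Longrightarrow> norm (T t (R y - \<mu> *\<^sub>C R y - R (R y))) \<le> C * norm y"
    using exists_error_constant by metis
  define N where "N t = onorm (\<lambda>x. T t (A (R (R x))))" for t
  define L where "L r = onorm (shift_inv D A (\<i> * complex_of_real r))" for r
  have res: "- \<i> * complex_of_real r \<in> op_resolvent_set D A" if "r \<noteq> 0" for r
  proof -
    have "- \<i> * complex_of_real r \<notin> op_spectrum D A \<inter> {z. Re z = 0}"
      unfolding assms(4) using that by simp
    then show ?thesis by (simp add: op_spectrum_def)
  qed
  have key: "min \<bar>r\<bar> (1 / \<bar>r\<bar>) / 8 \<le> N t"
    if "r \<noteq> 0" "0 \<le> t" "2 * K * t < L r" "8 * C < L r" "8 * C < \<bar>r\<bar> * L r" for r t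
    unfolding N_def by (rule lower_bound_at_imag[OF C(1) C(2) res[OF that(1)] that(1,2) L_def that(3-5)])
  have scaled: "onorm (\<lambda>x. s *\<^sub>R shift_inv D A (\<i> * complex_of_real r) x) = \<bar>s\<bar> * L r"
    if "r \<noteq> 0" for r s
    unfolding L_def by (rule onorm_scaleR[OF shift_inv_imag(3)[OF res[OF that]]])
  have "\<forall>\<^sub>F s in at 0. 8 * C < max (\<bar>s\<bar> * L s) (\<bar>s\<bar> * L (- s))"
  proof -
    have "\<forall>\<^sub>F s::real in at 0. s \<noteq> 0" by (simp add: eventually_at_filter)
    with assms(5)[unfolded filterlim_at_top_dense, rule_format, of "8 * C"] show ?thesis
    proof eventually_elim
      case (elim s)
      then show ?case using scaled[of s s] scaled[of "- s" s] by simp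
    qed
  qed
  then obtain \<delta> where \<delta>: "\<delta> > 0"
      "\<And>s. s \<noteq> 0 \<Longrightarrow> \<bar>s\<bar> < \<delta> \<Longrightarrow> 8 * C < max (\<bar>s\<bar> * L s) (\<bar>s\<bar> * L (- s))"
    by (auto simp: eventually_at dist_real_def)
  have K4: "0 < 4 * K" using K_ge_1 by simp
  have large: "filterlim (\<lambda>t. 4 * K * t) at_top at_top"
    by (rule filterlim_tendsto_pos_mult_at_top[OF tendsto_const K4 filterlim_ident])
  have ev_C: "\<forall>\<^sub>F t in at_top. 8 * C + 8 * C / \<delta> < 2 * K * t"
  proof -
    have "\<forall>\<^sub>F t in at_top. 2 * (8 * C + 8 * C / \<delta>) < 4 * K * t"
      using large unfolding filterlim_at_top_dense by blast
    then show ?thesis by eventually_elim simp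
  qed
  have ev_M: "\<forall>\<^sub>F t in at_top. Minv (4 * K * t) \<ge> 1 \<and> res_M D A (Minv (4 * K * t)) = 4 * K * t"
    using eventually_compose_filterlim[OF assms(7)[unfolded eventual_right_inverse_def] large] by simp
  have ev_m: "\<forall>\<^sub>F t in at_top. 0 < minv (4 * K * t) \<and> minv (4 * K * t) < 1
      \<and> res_m D A (minv (4 * K * t)) = 4 * K * t"
    using eventually_compose_filterlim[OF assms(8)[unfolded eventual_right_inverse_def] large] by simp
  have "\<forall>\<^sub>F t in at_top. N t \<ge> 1 / 8 * max (minv (4 * K * t)) (1 / Minv (4 * K * t))"
    using ev_C ev_M ev_m eventually_gt_at_top[of 0]
  proof eventually_elim
    case (elim t)
    have t: "2 * K * t < 4 * K * t" using K_ge_1 elim by simp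
    have C\<delta>: "8 * C < 2 * K * t" "8 * C / \<delta> < 2 * K * t"
      using elim(1) C(1) \<delta>(1) divide_nonneg_pos[of "8 * C" \<delta>] by linarith+
    have "1 / Minv (4 * K * t) / 8 \<le> N t"
    proof -
      define s where "s = Minv (4 * K * t)"
      obtain r where r: "1 \<le> \<bar>r\<bar>" "\<bar>r\<bar> \<le> s" "2 * K * t < L r"
        using exists_res_M_witness[of s "2 * K * t" D A] elim t by (auto simp: s_def L_def)
      have "L r \<le> \<bar>r\<bar> * L r" using r C\<delta> C(1) by (simp add: mult_right_mono[of 1 "\<bar>r\<bar>" "L r", simplified])
      with r C\<delta> elim have "min \<bar>r\<bar> (1 / \<bar>r\<bar>) / 8 \<le> N t" by (intro key) auto
      moreover have "1 / \<bar>r\<bar> \<le> 1"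
        using r(1) by (simp add: divide_le_eq_1)
      then have "min \<bar>r\<bar> (1 / \<bar>r\<bar>) = 1 / \<bar>r\<bar>"
        using r(1) by (intro min_absorb2) linarith
      moreover have "1 / s / 8 \<le> 1 / \<bar>r\<bar> / 8"
        using r by (intro divide_right_mono divide_left_mono) auto
      ultimately show ?thesis unfolding s_def by (metis order_trans)
    qed
    moreover have "minv (4 * K * t) / 8 \<le> N t"
    proof -
      define s where "s = minv (4 * K * t)"
      obtain r0 where r0: "s < \<bar>r0\<bar>" "\<bar>r0\<bar> \<le> 1" "2 * K * t < L r0"
        using exists_res_m_witness[of s "2 * K * t" D A] elim t by (auto simp: s_def L_def)
      define r where "r = (if L (- r0) \<le> L r0 then r0 else - r0)"
      have s: "0 < s" using elim by (simp add: s_def)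
      have r: "s < \<bar>r\<bar>" "\<bar>r\<bar> \<le> 1" "2 * K * t < L r" "L (- r) \<le> L r" "r \<noteq> 0"
        using r0 s by (auto simp: r_def)
      \<comment> \<open>Near zero the growth hypothesis applies to the better sign; away from zero \<open>L r\<close> exceeds a
        multiple of \<open>t\<close>.\<close>
      have "8 * C < \<bar>r\<bar> * L r"
      proof (cases "\<bar>r\<bar> < \<delta>")
        case True
        moreover have "\<bar>r\<bar> * L (- r) \<le> \<bar>r\<bar> * L r" using r(4) by (intro mult_left_mono) auto
        ultimately show ?thesis using \<delta>(2)[of r] r(5) by (simp add: max_def split: if_splits)
      next
        case False
        have "8 * C < \<delta> * (2 * K * t)" using C\<delta>(2) \<delta>(1) by (simp add: field_simps)
        also have "\<dots> \<le> \<bar>r\<bar> * L r" using False r \<delta>(1) K_ge_1 elim by (intro mult_mono) auto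
        finally show ?thesis .
      qed
      with r C\<delta> elim have "min \<bar>r\<bar> (1 / \<bar>r\<bar>) / 8 \<le> N t" by (intro key) auto
      moreover have "1 \<le> 1 / \<bar>r\<bar>" using r by simp
      ultimately show ?thesis using r by (simp add: s_def min_def split: if_splits)
    qed
    ultimately show ?case by (simp add: max_def)
  qed
  then show ?thesis unfolding N_def R_def using K4
    by (intro exI[of _ "1 / 8 :: real"] exI[of _ "4 * K"] conjI) auto
qed

end
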